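(* Let $\boldsymbol\beta\in H(\mathrm{div};\Omega)$ be constant on each element of the mesh $\mathcal T_h$, let $g=0$, $f\in L^2(\Omega)$, $\epsilon>0$, and let $\tau(F)=\max\big(\sup_{\boldsymbol x\in F}\boldsymbol\beta(\boldsymbol x)\cdot\boldsymbol n,\,0\big)$ for every face $F$ of every $K\in\mathcal T_h$ (with $\boldsymbol\beta$ and $\boldsymbol n$ taken from $K$). Then the HDG method with this $\tau$ and the approximation spaces $\widetilde{\boldsymbol V}_h\times W_h\times M_h(0)$ coincides with the MH--DG method: a triple $(\boldsymbol q_h,u_h,\lambda_h)\in\widetilde{\boldsymbol V}_h\times W_h\times M_h(0)$ satisfies $$B((\boldsymbol q_h,u_h,\lambda_h),(\boldsymbol r,w,\mu))=(f,w)_{\mathcal T_h}\quad\forall(\boldsymbol r,w,\mu)\in\widetilde{\boldsymbol V}_h\times W_h\times M_h(0)$$ if and only if it satisfies $$B_h((\boldsymbol q_h,u_h,\lambda_h),(\boldsymbol r,w,\mu))=(f,w)_{\mathcal T_h}\quad\forall(\boldsymbol r,w,\mu)\in\widetilde{\boldsymbol V}_h\times W_h\times M_h(0).$$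
   Context: $\Omega\subset\mathbb R^d$ ($d=2,3$) is a polyhedral domain and $\mathcal T_h$ a conforming, quasi-uniform simplicial triangulation with set of faces $\mathcal E_h$; $\boldsymbol n$ is the outward unit normal on $\partial K$. The underlying problem is $-\epsilon\Delta u+\boldsymbol\beta\cdot\nabla u=f$ in $\Omega$, $u=0$ on $\partial\Omega$. $(\eta,\zeta)_{\mathcal T_h}=\sum_K\int_K\eta\zeta$, $\langle\eta,\zeta\rangle_{\partial\mathcal T_h}=\sum_K\int_{\partial K}\eta\zeta$; differential operators act elementwise. Spaces, with $P_k$ the polynomials of total degree at most $k\ge0$: $\widetilde{\boldsymbol V}_h=\{\boldsymbol r\in L^2(\Omega;\mathbb R^d):\boldsymbol r|_K\in P_k(K;\mathbb R^d)+\boldsymbol xP_k(K)\ \forall K\in\mathcal T_h\}$ (Raviart--Thomas), $W_h=\{w\in L^2(\Omega):w|_K\in P_k(K)\ \forall K\in\mathcal T_h\}$, $M_h(0)=\{\mu\in L^2(\mathcal E_h):\mu|_F\in P_k(F)\ \forall F\in\mathcal E_h,\ \mu=0\text{ on }\partial\Omega\}$. HDG form: $$\begin{aligned}B((\boldsymbol q,u,\lambda),(\boldsymbol r,w,\mu))=&\ (\epsilon^{-1}\boldsymbol q,\boldsymbol r)_{\mathcal T_h}-(u,\nabla\cdot\boldsymbol r)_{\mathcal T_h}+\langle\lambda,\boldsymbol r\cdot\boldsymbol n\rangle_{\partial\mathcal T_h}-(\boldsymbol q+\boldsymbol\beta u,\nabla w)_{\mathcal T_h}\\&+\langle(\boldsymbol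 q+\boldsymbol\beta\lambda)\cdot\boldsymbol n+\tau(u-\lambda),w\rangle_{\partial\mathcal T_h}-((\nabla\cdot\boldsymbol\beta)u,w)_{\mathcal T_h}\\&-\langle(\boldsymbol q+\boldsymbol\beta\lambda)\cdot\boldsymbol n+\tau(u-\lambda),\mu\rangle_{\partial\mathcal T_h}.\end{aligned}$$ MH--DG (mixed-hybrid-discontinuous Galerkin) form: $$\begin{aligned}B_h((\boldsymbol q,u,\lambda),(\boldsymbol r,w,\mu))=&\ (\epsilon^{-1}\boldsymbol q,\boldsymbol r)_{\mathcal T_h}-(u,\nabla\cdot\boldsymbol r)_{\mathcal T_h}+\langle\lambda,\boldsymbol r\cdot\boldsymbol n\rangle_{\partial\mathcal T_h}\\&-(\boldsymbol q+\boldsymbol\beta u,\nabla w)_{\mathcal T_h}+\langle\boldsymbol q\cdot\boldsymbol n+\boldsymbol\beta\cdot\boldsymbol n\{\lambda/u\},w-\mu\rangle_{\partial\mathcal T_h},\end{aligned}$$ where the upwind value is $\{\lambda/u\}=\lambda$ if $\boldsymbol\beta\cdot\boldsymbol n<0$ and $\{\lambda/u\}=u$ if $\boldsymbol\beta\cdot\boldsymbol n\ge0$. *)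

theory Defs
  imports "HOL-Analysis.Analysis"
begin

section \<open>Domains and meshes\<close>

definition polyhedral_domain :: "(real^'n) set \<Rightarrow> bool" where
  "polyhedral_domain \<Omega> \<longleftrightarrow> \<Omega> \<noteq> {} \<and> connected \<Omega> \<and>
     (\<exists>\<P>. finite \<P> \<and> (\<forall>P\<in>\<P>. polytope P) \<and> \<Omega> = interior (\<Union>\<P>))"

text \<open>Elements are closed simplices of full dimension. The predicate \<^const>\<open>triangulation\<close> already
  requires that any two elements meet in a common face, i.e. that the mesh is conforming.\<close>

definition conforming_mesh :: "(real^'n) set \<Rightarrow> (real^'n) set set \<Rightarrow> bool" where
  "conforming_mesh \<Omega> \<T> \<longleftrightarrow> triangulation \<T> \<and> (\<forall>K\<in>\<T>. int CARD('n) simplex K) \<and>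
     \<Union>\<T> = closure \<Omega>"

definition inradius :: "(real^'n) set \<Rightarrow> real" where
  "inradius K = Sup {r. 0 \<le> r \<and> (\<exists>x. cball x r \<subseteq> K)}"

text \<open>A family of meshes is quasi-uniform iff one constant \<open>\<sigma>\<close> works for all its members.\<close>

definition quasi_uniform :: "real \<Rightarrow> (real^'n) set set \<Rightarrow> bool" where
  "quasi_uniform \<sigma> \<T> \<longleftrightarrow> (\<forall>K\<in>\<T>. Max (diameter ` \<T>) \<le> \<sigma> * inradius K)"

definition mesh_faces :: "(real^'n) set set \<Rightarrow> (real^'n) set set" where
  "mesh_faces \<T> = {F. \<exists>K\<in>\<T>. F facet_of K}"

definition outward_normal :: "(real^'n) set \<Rightarrow> (real^'n) set \<Rightarrow> real^'n" where
  "outward_normal K F = (THE n. norm n = 1 \<and>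
     (\<exists>c. (\<forall>x\<in>F. n \<bullet> x = c) \<and> (\<forall>x\<in>K. n \<bullet> x \<le> c)))"


section \<open>Integration\<close>

text \<open>The surface measure of a face is the Lebesgue measure of its affine hull: the image of product
  Lebesgue measure under an orthonormal coordinate system \<open>(p, B)\<close> of that hull (compare
  \<open>lborel_def\<close>), which does not depend on the choice of \<open>p\<close> and \<open>B\<close>. It is completed, as
  \<^const>\<open>lebesgue\<close> is.\<close>

definition tangent_basis :: "(real^'n) set \<Rightarrow> (real^'n) set" where
  "tangent_basis F = (SOME B. pairwise orthogonal B \<and> (\<forall>b\<in>B. norm b = 1) \<and>
     span B = span {x - y | x y. x \<in> F \<and> y \<in> F})"

definition surface_measure :: "(real^'n) set \<Rightarrow> (real^'n) measure" where
  "surface_measure F = completion (distr (\<Pi>\<^sub>M b\<in>tangent_basis F. lborel) borel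
     (\<lambda>c. (SOME p. p \<in> F) + (\<Sum>b\<in>tangent_basis F. c b *\<^sub>R b)))"

definition L2_on :: "'a measure \<Rightarrow> 'a set \<Rightarrow> ('a \<Rightarrow> 'b::{real_normed_vector, second_countable_topology}) set"
  where "L2_on M A = {f. set_borel_measurable M A f \<and> set_integrable M A (\<lambda>x. (norm (f x))\<^sup>2)}"

definition vol_pairing ::
    "(real^'n) set set \<Rightarrow> (real^'n \<Rightarrow> 'b::real_inner) \<Rightarrow> (real^'n \<Rightarrow> 'b) \<Rightarrow> real" where
  "vol_pairing \<T> \<eta> \<zeta> = (\<Sum>K\<in>\<T>. LINT x:K|lebesgue. \<eta> x \<bullet> \<zeta> x)"

text \<open>Functions on the element boundaries are in general two-valued on interior faces, so they
  take the element and its face as additional arguments.\<close>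

definition bdry_pairing :: "(real^'n) set set \<Rightarrow>
    ((real^'n) set \<Rightarrow> (real^'n) set \<Rightarrow> real^'n \<Rightarrow> real) \<Rightarrow>
    ((real^'n) set \<Rightarrow> (real^'n) set \<Rightarrow> real^'n \<Rightarrow> real) \<Rightarrow> real" where
  "bdry_pairing \<T> \<eta> \<zeta> =
     (\<Sum>K\<in>\<T>. \<Sum>F | F facet_of K. LINT x:F|surface_measure F. \<eta> K F x * \<zeta> K F x)"


section \<open>Differential operators and traces\<close>

text \<open>The functions below are piecewise smooth, possibly with jumps across element boundaries. The
  classical operators are therefore the elementwise ones at interior points of elements; the values
  on the element boundaries are immaterial in volume integrals.\<close>

definition grad :: "(real^'n \<Rightarrow> real) \<Rightarrow> real^'n \<Rightarrow> real^'n" where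
  "grad w x = (\<chi> i. frechet_derivative w (at x) (axis i 1))"

definition divergence :: "(real^'n \<Rightarrow> real^'n) \<Rightarrow> real^'n \<Rightarrow> real" where
  "divergence r x = (\<Sum>i\<in>UNIV. frechet_derivative r (at x) (axis i 1) $ i)"

definition elem_trace :: "(real^'n) set \<Rightarrow> (real^'n \<Rightarrow> 'b::t2_space) \<Rightarrow> real^'n \<Rightarrow> 'b" where
  "elem_trace K f x = Lim (at x within interior K) f"

primrec C_order :: "nat \<Rightarrow> (real^'n \<Rightarrow> real) \<Rightarrow> bool" where
  "C_order 0 \<phi> \<longleftrightarrow> continuous_on UNIV \<phi>"
| "C_order (Suc m) \<phi> \<longleftrightarrow> (\<forall>x. \<phi> differentiable (at x)) \<and> (\<forall>i. C_order m (\<lambda>x. grad \<phi> x $ i))"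

definition test_functions :: "(real^'n) set \<Rightarrow> (real^'n \<Rightarrow> real) set" where
  "test_functions \<Omega> = {\<phi>. (\<forall>m. C_order m \<phi>) \<and>
     compact (closure {x. \<phi> x \<noteq> 0}) \<and> closure {x. \<phi> x \<noteq> 0} \<subseteq> \<Omega>}"

definition H_div :: "(real^'n) set \<Rightarrow> (real^'n \<Rightarrow> real^'n) set" where
  "H_div \<Omega> = {\<beta> \<in> L2_on lebesgue \<Omega>. \<exists>g\<in>L2_on lebesgue \<Omega>. \<forall>\<phi>\<in>test_functions \<Omega>.
     (LINT x:\<Omega>|lebesgue. \<beta> x \<bullet> grad \<phi> x) = - (LINT x:\<Omega>|lebesgue. g x * \<phi> x)}"

text \<open>On each element we use the representative that is constant in its interior.\<close>

definition elementwise_constant :: "(real^'n) set set \<Rightarrow> (real^'n \<Rightarrow> 'b) \<Rightarrow> bool" where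
  "elementwise_constant \<T> \<beta> \<longleftrightarrow> (\<forall>K\<in>\<T>. \<exists>b. \<forall>x\<in>interior K. \<beta> x = b)"


section \<open>Approximation spaces\<close>

definition poly_space :: "nat \<Rightarrow> (real^'n \<Rightarrow> real) set" where
  "poly_space k = {p. \<exists>c :: ('n \<Rightarrow> nat) \<Rightarrow> real. \<forall>x.
     p x = (\<Sum>\<alpha> | (\<Sum>i\<in>UNIV. \<alpha> i) \<le> k. c \<alpha> * (\<Prod>i\<in>UNIV. x $ i ^ \<alpha> i))}"

text \<open>Elements of the volume spaces are taken to be the representatives of their \<open>L\<^sup>2\<close> classes that
  are polynomial at every interior point of an element, so that derivatives and traces make sense
  for them. No such choice is needed for the hybrid variable.\<close>

definition RT_space :: "nat \<Rightarrow> (real^'n) set \<Rightarrow> (real^'n) set set \<Rightarrow> (real^'n \<Rightarrow> real^'n) set" where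
  "RT_space k \<Omega> \<T> = {r \<in> L2_on lebesgue \<Omega>. \<forall>K\<in>\<T>. \<exists>p s.
     (\<forall>i. (\<lambda>x. p x $ i) \<in> poly_space k) \<and> s \<in> poly_space k \<and>
     (\<forall>x\<in>interior K. r x = p x + s x *\<^sub>R x)}"

definition W_space :: "nat \<Rightarrow> (real^'n) set \<Rightarrow> (real^'n) set set \<Rightarrow> (real^'n \<Rightarrow> real) set" where
  "W_space k \<Omega> \<T> = {w \<in> L2_on lebesgue \<Omega>. \<forall>K\<in>\<T>. \<exists>p\<in>poly_space k. \<forall>x\<in>interior K. w x = p x}"

definition M0_space :: "nat \<Rightarrow> (real^'n) set \<Rightarrow> (real^'n) set set \<Rightarrow> (real^'n \<Rightarrow> real) set" where
  "M0_space k \<Omega> \<T> = {\<mu>. \<forall>F\<in>mesh_faces \<T>. \<mu> \<in> L2_on (surface_measure F) F \<and>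
     (\<exists>p\<in>poly_space k. AE x in surface_measure F. x \<in> F \<longrightarrow> \<mu> x = p x) \<and>
     (F \<subseteq> frontier \<Omega> \<longrightarrow> (AE x in surface_measure F. x \<in> F \<longrightarrow> \<mu> x = 0))}"


section \<open>The two bilinear forms\<close>

text \<open>The stabilization parameter \<open>\<tau>\<close> takes the element and its face as arguments.\<close>

definition HDG_flux where
  "HDG_flux \<beta> \<tau> q u l K F x =
     (elem_trace K q x + l x *\<^sub>R elem_trace K \<beta> x) \<bullet> outward_normal K F
       + \<tau> K F * (elem_trace K u x - l x)"

fun HDG_form :: "(real^'n) set set \<Rightarrow> real \<Rightarrow> (real^'n \<Rightarrow> real^'n) \<Rightarrow>
    ((real^'n) set \<Rightarrow> (real^'n) set \<Rightarrow> real) \<Rightarrow>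
    (real^'n \<Rightarrow> real^'n) \<times> (real^'n \<Rightarrow> real) \<times> (real^'n \<Rightarrow> real) \<Rightarrow>
    (real^'n \<Rightarrow> real^'n) \<times> (real^'n \<Rightarrow> real) \<times> (real^'n \<Rightarrow> real) \<Rightarrow> real" where
  "HDG_form \<T> \<epsilon> \<beta> \<tau> (q, u, l) (r, w, \<mu>) =
     vol_pairing \<T> (\<lambda>x. inverse \<epsilon> *\<^sub>R q x) r
     - vol_pairing \<T> u (divergence r)
     + bdry_pairing \<T> (\<lambda>K F x. l x) (\<lambda>K F x. elem_trace K r x \<bullet> outward_normal K F)
     - vol_pairing \<T> (\<lambda>x. q x + u x *\<^sub>R \<beta> x) (grad w)
     + bdry_pairing \<T> (HDG_flux \<beta> \<tau> q u l) (\<lambda>K F x. elem_trace K w x)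
     - vol_pairing \<T> (\<lambda>x. divergence \<beta> x * u x) w
     - bdry_pairing \<T> (HDG_flux \<beta> \<tau> q u l) (\<lambda>K F x. \<mu> x)"

definition upwind where
  "upwind \<beta> l u K F x =
     (if elem_trace K \<beta> x \<bullet> outward_normal K F < 0 then l x else elem_trace K u x)"

fun MHDG_form :: "(real^'n) set set \<Rightarrow> real \<Rightarrow> (real^'n \<Rightarrow> real^'n) \<Rightarrow>
    (real^'n \<Rightarrow> real^'n) \<times> (real^'n \<Rightarrow> real) \<times> (real^'n \<Rightarrow> real) \<Rightarrow>
    (real^'n \<Rightarrow> real^'n) \<times> (real^'n \<Rightarrow> real) \<times> (real^'n \<Rightarrow> real) \<Rightarrow> real" where
  "MHDG_form \<T> \<epsilon> \<beta> (q, u, l) (r, w, \<mu>) =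
     vol_pairing \<T> (\<lambda>x. inverse \<epsilon> *\<^sub>R q x) r
     - vol_pairing \<T> u (divergence r)
     + bdry_pairing \<T> (\<lambda>K F x. l x) (\<lambda>K F x. elem_trace K r x \<bullet> outward_normal K F)
     - vol_pairing \<T> (\<lambda>x. q x + u x *\<^sub>R \<beta> x) (grad w)
     + bdry_pairing \<T>
         (\<lambda>K F x. elem_trace K q x \<bullet> outward_normal K F
            + (elem_trace K \<beta> x \<bullet> outward_normal K F) * upwind \<beta> l u K F x)
         (\<lambda>K F x. elem_trace K w x - \<mu> x)"

end

theory Submission
  imports Defs
begin

text \<open>
  The two forms agree for all trial functions \<open>(q, u, l)\<close> and test functions \<open>(r, w, \<mu>)\<close> of the
  discrete spaces, so the two variational problems are literally the same. They look different in
  three places.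

  \<^item> The volume term with \<open>divergence \<beta>\<close> occurs in the HDG form only. It vanishes because \<open>\<beta>\<close> is
    constant inside each element and the element boundaries are null sets
    (\<open>divergence_const_on_interior\<close>, \<open>vol_pairing_zero_on_interiors\<close>).
  \<^item> The numerical fluxes are given by different formulas. On a face \<open>F\<close> of \<open>K\<close> the number
    \<open>c = \<beta> \<bullet> n\<close> is constant, so \<open>\<tau> K F = max c 0\<close>. If \<open>c < 0\<close>, both fluxes are \<open>q \<bullet> n + c l\<close>; if
    \<open>c \<ge> 0\<close>, then \<open>c l + \<tau> (u - l) = c u\<close>, which is the upwind value. Thus the fluxes agree pointwise
    on \<open>F\<close> (\<open>HDG_flux_eq_MHDG_flux\<close>).
  \<^item> The HDG form tests the flux against \<open>w\<close> and \<open>\<mu>\<close> separately, the MH--DG form tests it against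
    \<open>w - \<mu>\<close>. Splitting the integral requires both products to be integrable over each face.

  Integrability is the analytic part of the argument. Traces of the volume functions are restrictions
  of continuous functions to a compact face (\<open>elem_trace_eq\<close>), and a face has finite surface measure
  (\<open>emeasure_surface_measure_bounded\<close>), so these traces are square integrable; the hybrid
  functions are square integrable by definition of their space. Hence both products are integrable
  (\<open>MHDG_flux_integrable\<close>).
\<close>

section \<open>Traces from an element\<close>

lemma full_simplex_regular_closed:
  fixes K :: "(real^'n) set"
  assumes "int CARD('n) simplex K"
  shows "closure (interior K) = K"
proof -
  have "convex K" "closed K"
    using assms convex_simplex closed_simplex by blast+
  have "interior K = rel_interior K"
    using aff_dim_simplex[OF assms] by (simp add: interior_rel_interior_gen)
  then show ?thesis
    using \<open>convex K\<close> \<open>closed K\<close> convex_closure_rel_interior by fastforce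
qed

text \<open>The trace is a limit from the interior, and every point of \<open>K\<close>, boundary or not, is a limit point
  of the interior of \<open>K\<close>. The limit is therefore unique and equals the value at \<open>x\<close> of the continuous function
  that \<open>f\<close> agrees with there.\<close>

lemma elem_trace_eq:
  fixes K :: "(real^'n) set" and g :: "real^'n \<Rightarrow> 'b::t2_space"
  assumes K: "int CARD('n) simplex K" and x: "x \<in> K"
    and g: "continuous_on UNIV g" and f: "\<forall>y\<in>interior K. f y = g y"
  shows "elem_trace K f x = g x"
proof -
  have "x islimpt interior K"
  proof (cases "x \<in> interior K")
    case True
    then show ?thesis
      using interior_limit_point by fastforce
  next
    case False
    then show ?thesis
      using x full_simplex_regular_closed[OF K] by (auto simp: closure_def)
  qed
  then have "at x within interior K \<noteq> bot"
    by (simp add: trivial_limit_within)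
  moreover have "(f \<longlongrightarrow> g x) (at x within interior K)"
  proof (rule Lim_transform_eventually)
    show "(g \<longlongrightarrow> g x) (at x within interior K)"
      using g by (meson UNIV_I continuous_on_def subset_UNIV tendsto_within_subset)
    show "\<forall>\<^sub>F y in at x within interior K. g y = f y"
      using f by (simp add: eventually_at_filter)
  qed
  ultimately show ?thesis
    unfolding elem_trace_def by (rule tendsto_Lim)
qed

lemma continuous_poly_space:
  assumes "p \<in> poly_space k"
  shows "continuous_on UNIV p"
proof -
  obtain c where "p = (\<lambda>x. \<Sum>\<alpha> | (\<Sum>i\<in>UNIV. \<alpha> i) \<le> k. c \<alpha> * (\<Prod>i\<in>UNIV. x $ i ^ \<alpha> i))"
    using assms unfolding poly_space_def by fastforce
  then show ?thesis
    by (auto intro!: continuous_intros)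
qed

lemma RT_space_elem_trace:
  fixes K :: "(real^'n) set"
  assumes "r \<in> RT_space k \<Omega> \<T>" "K \<in> \<T>" and K: "int CARD('n) simplex K"
  obtains g where "continuous_on UNIV g" "\<And>x. x \<in> K \<Longrightarrow> elem_trace K r x = g x"
proof -
  obtain p s where p: "\<forall>i. (\<lambda>x. p x $ i) \<in> poly_space k" and s: "s \<in> poly_space k"
    and r: "\<forall>x\<in>interior K. r x = p x + s x *\<^sub>R x"
    using assms unfolding RT_space_def by blast
  have "continuous_on UNIV (\<lambda>x. (\<chi> i. p x $ i))"
    using p by (intro continuous_on_vec_lambda) (blast intro: continuous_poly_space)
  then have "continuous_on UNIV (\<lambda>x. p x + s x *\<^sub>R x)"
    using s by (intro continuous_intros continuous_poly_space) auto
  with elem_trace_eq[OF K _ this r] that show thesis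
    by blast
qed

lemma W_space_elem_trace:
  fixes K :: "(real^'n) set"
  assumes "w \<in> W_space k \<Omega> \<T>" "K \<in> \<T>" and K: "int CARD('n) simplex K"
  obtains g where "continuous_on UNIV g" "\<And>x. x \<in> K \<Longrightarrow> elem_trace K w x = g x"
proof -
  obtain p where p: "p \<in> poly_space k" and w: "\<forall>x\<in>interior K. w x = p x"
    using assms unfolding W_space_def by blast
  from elem_trace_eq[OF K _ continuous_poly_space[OF p] w] that p continuous_poly_space
  show thesis by blast
qed

section \<open>Square integrability on faces\<close>

lemma tangent_basis_orthonormal:
  shows "finite (tangent_basis F)" "pairwise orthogonal (tangent_basis F)"
    "\<And>b. b \<in> tangent_basis F \<Longrightarrow> norm b = 1"
proof -
  let ?S = "span {x - y | x y. x \<in> F \<and> y \<in> F}"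
  have "\<exists>B. pairwise orthogonal B \<and> (\<forall>b\<in>B. norm b = 1) \<and> span B = ?S"
    by (rule orthonormal_basis_subspace[OF subspace_span, of "{x - y | x y. x \<in> F \<and> y \<in> F}"]) blast
  then have B: "pairwise orthogonal (tangent_basis F) \<and> (\<forall>b\<in>tangent_basis F. norm b = 1)
      \<and> span (tangent_basis F) = ?S"
    unfolding tangent_basis_def by (rule someI_ex)
  then show "pairwise orthogonal (tangent_basis F)"
    "\<And>b. b \<in> tangent_basis F \<Longrightarrow> norm b = 1" by auto
  then have "independent (tangent_basis F)"
    by (intro pairwise_orthogonal_independent) force+
  then show "finite (tangent_basis F)"
    by (rule independent_imp_finite)
qed

lemma borel_subset_sets_surface_measure: "sets borel \<subseteq> sets (surface_measure F)"
  unfolding surface_measure_def by (auto intro: sets_completionI_sets)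

text \<open>Orthonormal coordinates do not exceed distances: the coordinate vectors of the points of a
  bounded set lie in a cube of finite side length, whose product measure is finite.\<close>

lemma emeasure_surface_measure_bounded:
  fixes F :: "(real^'n) set"
  assumes "bounded A" "A \<in> sets borel"
  shows "emeasure (surface_measure F) A < \<infinity>"
proof -
  define B where "B = tangent_basis F"
  define p where "p = (SOME p. p \<in> F)"
  define \<phi> where "\<phi> = (\<lambda>c. p + (\<Sum>b\<in>B. c b *\<^sub>R b))"
  let ?M = "\<Pi>\<^sub>M b\<in>B. (lborel :: real measure)"
  have B: "finite B" "pairwise orthogonal B" "\<And>b. b \<in> B \<Longrightarrow> norm b = 1"
    using tangent_basis_orthonormal unfolding B_def by auto
  interpret product_sigma_finite "\<lambda>b. lborel :: real measure"
    by (simp add: lborel.sigma_finite_measure_axioms product_sigma_finite_def)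
  have \<phi>: "\<phi> \<in> measurable ?M borel"
    unfolding \<phi>_def by measurable
  obtain R where R: "\<And>x. x \<in> A \<Longrightarrow> norm (x - p) \<le> R"
    using assms(1) bounded_iff[of "(\<lambda>x. x - p) ` A"] bounded_translation_minus by blast
  have coord: "(\<phi> c - p) \<bullet> b = c b" if "b \<in> B" for b c
  proof -
    have "(\<phi> c - p) \<bullet> b = (\<Sum>a\<in>B. c a * (a \<bullet> b))"
      by (simp add: \<phi>_def inner_sum_left)
    also have "\<dots> = (\<Sum>a\<in>B. if a = b then c b else 0)"
      using B that by (intro sum.cong) (auto simp: pairwise_def orthogonal_def norm_eq_1)
    also have "\<dots> = c b"
      using B(1) that by simp
    finally show ?thesis .
  qed
  have "\<phi> -` A \<inter> space ?M \<subseteq> (\<Pi>\<^sub>E b\<in>B. {-R..R})"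
  proof
    fix c assume c: "c \<in> \<phi> -` A \<inter> space ?M"
    have "\<bar>c b\<bar> \<le> R" if "b \<in> B" for b
    proof -
      have "\<bar>c b\<bar> \<le> norm (\<phi> c - p)"
        using Cauchy_Schwarz_ineq2[of "\<phi> c - p" b] coord[OF that] B(3)[OF that] by simp
      also have "\<dots> \<le> R"
        using R c by simp
      finally show ?thesis .
    qed
    then show "c \<in> (\<Pi>\<^sub>E b\<in>B. {-R..R})"
      using c by (auto simp: space_PiM PiE_iff abs_le_iff minus_le_iff)
  qed
  then have "emeasure ?M (\<phi> -` A \<inter> space ?M) \<le> emeasure ?M (\<Pi>\<^sub>E b\<in>B. {-R..R})"
    using B(1) by (intro emeasure_mono sets_PiM_I_finite) auto
  also have "\<dots> = (\<Prod>b\<in>B. emeasure lborel {-R..R})"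
    using B(1) by (intro emeasure_PiM) auto
  also have "\<dots> < \<infinity>"
    by (simp add: ennreal_prod_eq_top less_top[symmetric] power_eq_top_ennreal emeasure_lborel_Icc_eq)
  finally have "emeasure (distr ?M borel \<phi>) A < \<infinity>"
    using \<phi> assms(2) by (simp add: emeasure_distr)
  then show ?thesis
    using assms(2) unfolding surface_measure_def B_def[symmetric] p_def[symmetric]
    by (simp flip: \<phi>_def)
qed

lemma continuous_in_L2_surface_measure:
  fixes F :: "(real^'n) set" and g :: "real^'n \<Rightarrow> real"
  assumes "compact F" "continuous_on UNIV g"
  shows "g \<in> L2_on (surface_measure F) F"
proof -
  have F: "F \<in> sets (surface_measure F)"
    using borel_compact[OF assms(1)] borel_subset_sets_surface_measure by blast
  have "borel_measurable borel \<subseteq> borel_measurable (surface_measure F)"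
    using borel_subset_sets_surface_measure[of F]
    by (intro measurable_mono) (auto simp: surface_measure_def)
  then have g: "g \<in> borel_measurable (surface_measure F)"
    using assms(2) borel_measurable_continuous_onI by blast
  have "bounded ((\<lambda>x. (norm (g x))\<^sup>2) ` F)"
    using assms by (intro compact_imp_bounded compact_continuous_image continuous_intros)
      (auto intro: continuous_on_subset)
  then obtain C where C: "\<And>x. x \<in> F \<Longrightarrow> norm ((norm (g x))\<^sup>2) \<le> C"
    unfolding bounded_iff by blast
  have "emeasure (surface_measure F) F < \<infinity>"
    using emeasure_surface_measure_bounded[OF compact_imp_bounded[OF assms(1)] borel_compact[OF assms(1)]] .
  then have "set_integrable (surface_measure F) F (\<lambda>x. (norm (g x))\<^sup>2)"
    unfolding set_integrable_def using F g C
    by (intro integrableI_bounded_set_indicator[where B=C]) auto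
  then show ?thesis
    using F g unfolding L2_on_def set_borel_measurable_def by simp
qed

text \<open>The bound \<open>\<bar>f g\<bar> \<le> f\<^sup>2 + g\<^sup>2\<close> replaces the Cauchy--Schwarz inequality, as only finiteness of the
  integral matters.\<close>

lemma L2_on_mult_integrable:
  fixes f g :: "'a \<Rightarrow> real"
  assumes "f \<in> L2_on M A" "g \<in> L2_on M A"
  shows "set_integrable M A (\<lambda>x. f x * g x)"
proof -
  have "set_integrable M A (\<lambda>x. (norm (f x))\<^sup>2 + (norm (g x))\<^sup>2)"
    using assms unfolding L2_on_def by (auto intro: set_integral_add)
  then show ?thesis
    unfolding set_integrable_def
  proof (rule Bochner_Integration.integrable_bound)
    have "(\<lambda>x. (indicator A x *\<^sub>R f x) * (indicator A x *\<^sub>R g x)) \<in> borel_measurable M"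
      using assms unfolding L2_on_def set_borel_measurable_def by (intro borel_measurable_times) auto
    moreover have "(indicator A x *\<^sub>R f x) * (indicator A x *\<^sub>R g x) = indicator A x *\<^sub>R (f x * g x)" for x
      by (simp add: indicator_def)
    ultimately show "(\<lambda>x. indicator A x *\<^sub>R (f x * g x)) \<in> borel_measurable M"
      by (simp only:)
    have "\<bar>a * b\<bar> \<le> a\<^sup>2 + b\<^sup>2" for a b :: real
    proof -
      have "2 * (\<bar>a\<bar> * \<bar>b\<bar>) \<le> a\<^sup>2 + b\<^sup>2"
        using sum_squares_bound[of "\<bar>a\<bar>" "\<bar>b\<bar>"] by (simp add: mult.assoc)
      moreover have "0 \<le> \<bar>a\<bar> * \<bar>b\<bar>"
        by simp
      ultimately show ?thesis
        unfolding abs_mult by linarith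
    qed
    then show "AE x in M. norm (indicator A x *\<^sub>R (f x * g x))
        \<le> norm (indicator A x *\<^sub>R ((norm (f x))\<^sup>2 + (norm (g x))\<^sup>2))"
      by (auto simp: indicator_def)
  qed
qed

section \<open>The divergence term\<close>

lemma divergence_const_on_interior:
  assumes "\<forall>y\<in>interior K. \<beta> y = b" "x \<in> interior K"
  shows "divergence \<beta> x = 0"
proof -
  have "((\<lambda>y. b) has_derivative (\<lambda>h. 0)) (at x)"
    by simp
  then have "(\<beta> has_derivative (\<lambda>h. 0)) (at x)"
    by (rule has_derivative_transform_within_open[OF _ open_interior assms(2)]) (use assms in auto)
  then have "frechet_derivative \<beta> (at x) = (\<lambda>h. 0)"
    using frechet_derivative_at by metis
  then show ?thesis
    by (simp add: divergence_def)
qed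

text \<open>On the element boundaries \<open>\<eta>\<close> may take any values, for instance those of \<open>divergence \<beta>\<close> at
  jumps of \<open>\<beta>\<close>: the frontier of a convex set is negligible.\<close>

lemma vol_pairing_zero_on_interiors:
  assumes "\<And>K. K \<in> \<T> \<Longrightarrow> convex K" "\<And>K x. K \<in> \<T> \<Longrightarrow> x \<in> interior K \<Longrightarrow> \<eta> x = 0"
  shows "vol_pairing \<T> \<eta> \<zeta> = 0"
  unfolding vol_pairing_def
proof (intro sum.neutral ballI)
  fix K assume K: "K \<in> \<T>"
  have "AE x in lebesgue. x \<notin> frontier K"
    using negligible_convex_frontier[OF assms(1)[OF K]]
    by (intro AE_not_in) (simp add: negligible_iff_null_sets)
  then have "AE x in lebesgue. indicator K x *\<^sub>R (\<eta> x \<bullet> \<zeta> x) = 0"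
  proof (rule AE_mp, intro AE_I2 impI)
    fix x assume "x \<notin> frontier K"
    then have "x \<in> interior K" if "x \<in> K"
      using that closure_subset[of K] by (auto simp: frontier_def)
    with assms(2)[OF K] show "indicator K x *\<^sub>R (\<eta> x \<bullet> \<zeta> x) = 0"
      by (auto simp: indicator_def)
  qed
  then show "(LINT x:K|lebesgue. \<eta> x \<bullet> \<zeta> x) = 0"
    unfolding set_lebesgue_integral_def by (rule integral_eq_zero_AE)
qed

section \<open>The numerical fluxes\<close>

definition MHDG_flux where
  "MHDG_flux \<beta> q u l K F x = elem_trace K q x \<bullet> outward_normal K F
     + (elem_trace K \<beta> x \<bullet> outward_normal K F) * upwind \<beta> l u K F x"

text \<open>As \<open>\<beta> \<bullet> n\<close> is constant on the face, its supremum is its value at \<open>x\<close>, and the stabilization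
  \<open>\<tau> (u - l)\<close> turns \<open>l\<close> into \<open>u\<close> exactly when \<open>\<beta> \<bullet> n\<close> is nonnegative.\<close>

lemma HDG_flux_eq_MHDG_flux:
  assumes "\<And>y. y \<in> F \<Longrightarrow> elem_trace K \<beta> y = b" "x \<in> F"
    and "\<tau> K F = max (SUP y\<in>F. elem_trace K \<beta> y \<bullet> outward_normal K F) 0"
  shows "HDG_flux \<beta> \<tau> q u l K F x = MHDG_flux \<beta> q u l K F x"
proof -
  have "(SUP y\<in>F. elem_trace K \<beta> y \<bullet> outward_normal K F) = (SUP y\<in>F. b \<bullet> outward_normal K F)"
    using assms(1) by (intro SUP_cong) auto
  also have "\<dots> = b \<bullet> outward_normal K F"
    using assms(2) by (intro cSUP_const) auto
  finally have "\<tau> K F = max (b \<bullet> outward_normal K F) 0"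
    using assms(3) by simp
  then show ?thesis
    using assms(1,2) unfolding HDG_flux_def MHDG_flux_def upwind_def
    by (auto simp: algebra_simps max_def)
qed

text \<open>On a face the sign of \<open>\<beta> \<bullet> n\<close> does not vary, so the upwind value is either \<open>l\<close> throughout or the
  trace of \<open>u\<close> throughout, and the flux is a linear combination of two square integrable functions.\<close>

lemma MHDG_flux_integrable:
  fixes K F :: "(real^'n) set" and v :: "real^'n \<Rightarrow> real"
  assumes q: "q \<in> RT_space k \<Omega> \<T>" and u: "u \<in> W_space k \<Omega> \<T>"
    and l: "l \<in> L2_on (surface_measure F) F"
    and K: "K \<in> \<T>" "int CARD('n) simplex K"
    and F: "compact F" "F \<subseteq> K"
    and b: "\<And>y. y \<in> F \<Longrightarrow> elem_trace K \<beta> y = b"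
    and v: "v \<in> L2_on (surface_measure F) F"
  shows "set_integrable (surface_measure F) F (\<lambda>x. MHDG_flux \<beta> q u l K F x * v x)"
proof -
  let ?n = "outward_normal K F"
  obtain gq where gq: "continuous_on UNIV gq" "\<And>x. x \<in> K \<Longrightarrow> elem_trace K q x = gq x"
    using RT_space_elem_trace[OF q K] by metis
  obtain gu where gu: "continuous_on UNIV gu" "\<And>x. x \<in> K \<Longrightarrow> elem_trace K u x = gu x"
    using W_space_elem_trace[OF u K] by metis
  \<comment> \<open>the upwind value on \<open>F\<close>\<close>
  define h where "h = (if b \<bullet> ?n < 0 then l else gu)"
  have "h \<in> L2_on (surface_measure F) F"
    using l continuous_in_L2_surface_measure[OF F(1) gu(1)] by (simp add: h_def)
  moreover have "(\<lambda>x. gq x \<bullet> ?n) \<in> L2_on (surface_measure F) F"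
    by (intro continuous_in_L2_surface_measure F continuous_intros gq)
  ultimately have "set_integrable (surface_measure F) F
      (\<lambda>x. (gq x \<bullet> ?n) * v x + (b \<bullet> ?n) * (h x * v x))"
    by (intro set_integral_add set_integrable_mult_right L2_on_mult_integrable v)
  moreover have "set_integrable (surface_measure F) F (\<lambda>x. MHDG_flux \<beta> q u l K F x * v x)
      \<longleftrightarrow> set_integrable (surface_measure F) F
            (\<lambda>x. (gq x \<bullet> ?n) * v x + (b \<bullet> ?n) * (h x * v x))"
  proof (intro set_integrable_cong refl)
    fix x assume x: "x \<in> F"
    with F(2) gq(2) gu(2) b[OF x]
    show "MHDG_flux \<beta> q u l K F x * v x = (gq x \<bullet> ?n) * v x + (b \<bullet> ?n) * (h x * v x)"
      by (auto simp: MHDG_flux_def upwind_def h_def algebra_simps)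
  qed
  ultimately show ?thesis by blast
qed

section \<open>Equality of the two forms\<close>

lemma bdry_pairing_cong:
  assumes "\<And>K F x. K \<in> \<T> \<Longrightarrow> F facet_of K \<Longrightarrow> x \<in> F \<Longrightarrow> \<eta> K F x = \<eta>' K F x"
  shows "bdry_pairing \<T> \<eta> \<zeta> = bdry_pairing \<T> \<eta>' \<zeta>"
  unfolding bdry_pairing_def set_lebesgue_integral_def
  by (intro sum.cong refl Bochner_Integration.integral_cong) (auto simp: assms indicator_def)

lemma bdry_pairing_diff:
  assumes "\<And>K F. K \<in> \<T> \<Longrightarrow> F facet_of K \<Longrightarrow>
      set_integrable (surface_measure F) F (\<lambda>x. \<eta> K F x * \<zeta> K F x)"
    and "\<And>K F. K \<in> \<T> \<Longrightarrow> F facet_of K \<Longrightarrow>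
      set_integrable (surface_measure F) F (\<lambda>x. \<eta> K F x * \<xi> K F x)"
  shows "bdry_pairing \<T> \<eta> (\<lambda>K F x. \<zeta> K F x - \<xi> K F x) = bdry_pairing \<T> \<eta> \<zeta> - bdry_pairing \<T> \<eta> \<xi>"
  unfolding bdry_pairing_def sum_subtractf[symmetric]
  using assms by (intro sum.cong refl) (simp add: right_diff_distrib set_integral_diff)

theorem mainTheorem8:
  fixes \<Omega> :: "(real^'n) set" and \<T> :: "(real^'n) set set"
    and \<beta> :: "real^'n \<Rightarrow> real^'n" and f :: "real^'n \<Rightarrow> real"
    and \<epsilon> \<sigma> :: real and k :: nat
    and \<tau> :: "(real^'n) set \<Rightarrow> (real^'n) set \<Rightarrow> real"
    and q :: "real^'n \<Rightarrow> real^'n" and u l :: "real^'n \<Rightarrow> real"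
  assumes "CARD('n) = 2 \<or> CARD('n) = 3"
    and "polyhedral_domain \<Omega>"
    and "conforming_mesh \<Omega> \<T>"
    and "quasi_uniform \<sigma> \<T>"
    and "\<beta> \<in> H_div \<Omega>"
    and "elementwise_constant \<T> \<beta>"
    and "f \<in> L2_on lebesgue \<Omega>"
    and "\<epsilon> > 0"
    and "\<And>K F. K \<in> \<T> \<Longrightarrow> F facet_of K \<Longrightarrow>
           \<tau> K F = max (SUP x\<in>F. elem_trace K \<beta> x \<bullet> outward_normal K F) 0"
    and "q \<in> RT_space k \<Omega> \<T>" and "u \<in> W_space k \<Omega> \<T>" and "l \<in> M0_space k \<Omega> \<T>"
  shows "(\<forall>r\<in>RT_space k \<Omega> \<T>. \<forall>w\<in>W_space k \<Omega> \<T>. \<forall>\<mu>\<in>M0_space k \<Omega> \<T>.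
            HDG_form \<T> \<epsilon> \<beta> \<tau> (q, u, l) (r, w, \<mu>) = vol_pairing \<T> f w)
     \<longleftrightarrow> (\<forall>r\<in>RT_space k \<Omega> \<T>. \<forall>w\<in>W_space k \<Omega> \<T>. \<forall>\<mu>\<in>M0_space k \<Omega> \<T>.
            MHDG_form \<T> \<epsilon> \<beta> (q, u, l) (r, w, \<mu>) = vol_pairing \<T> f w)"
proof -
  have simplex: "int CARD('n) simplex K" if "K \<in> \<T>" for K
    using assms(3) that unfolding conforming_mesh_def by blast
  have facet: "compact F" "F \<subseteq> K" if "K \<in> \<T>" "F facet_of K" for K F
    using simplex[OF that(1)] that(2) face_of_imp_compact facet_of_imp_face_of
      compact_simplex convex_simplex facet_of_imp_subset by blast+
  obtain b where b: "\<And>K x. K \<in> \<T> \<Longrightarrow> x \<in> interior K \<Longrightarrow> \<beta> x = b K"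
    using assms(6) unfolding elementwise_constant_def by metis
  have trace_\<beta>: "elem_trace K \<beta> x = b K" if "K \<in> \<T>" "x \<in> K" for K x
    by (rule elem_trace_eq[OF simplex]) (use b that in auto)
  have div_\<beta>: "vol_pairing \<T> (\<lambda>x. divergence \<beta> x * u x) w = 0" for w
  proof (rule vol_pairing_zero_on_interiors)
    show "convex K" if "K \<in> \<T>" for K
      using simplex[OF that] by (rule convex_simplex)
    show "divergence \<beta> x * u x = 0" if "K \<in> \<T>" "x \<in> interior K" for K x
      using divergence_const_on_interior[of K \<beta> "b K" x] b that by simp
  qed
  have L2_M0: "\<nu> \<in> L2_on (surface_measure F) F"
    if "\<nu> \<in> M0_space k \<Omega> \<T>" "K \<in> \<T>" "F facet_of K" for \<nu> K F
    using that unfolding M0_space_def mesh_faces_def by blast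
  have flux: "bdry_pairing \<T> (HDG_flux \<beta> \<tau> q u l) \<zeta> = bdry_pairing \<T> (MHDG_flux \<beta> q u l) \<zeta>" for \<zeta>
  proof (rule bdry_pairing_cong)
    fix K F x assume KF: "K \<in> \<T>" "F facet_of K" and "x \<in> F"
    with trace_\<beta>[OF KF(1)] facet(2)[OF KF] assms(9)[OF KF]
    show "HDG_flux \<beta> \<tau> q u l K F x = MHDG_flux \<beta> q u l K F x"
      by (intro HDG_flux_eq_MHDG_flux[where b = "b K"]) auto
  qed
  have "HDG_form \<T> \<epsilon> \<beta> \<tau> (q, u, l) (r, w, \<mu>) = MHDG_form \<T> \<epsilon> \<beta> (q, u, l) (r, w, \<mu>)"
    if w: "w \<in> W_space k \<Omega> \<T>" and \<mu>: "\<mu> \<in> M0_space k \<Omega> \<T>" for r w \<mu>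
  proof -
    have integrable: "set_integrable (surface_measure F) F (\<lambda>x. MHDG_flux \<beta> q u l K F x * v x)"
      if KF: "K \<in> \<T>" "F facet_of K" and v: "v \<in> L2_on (surface_measure F) F" for K F v
      using MHDG_flux_integrable[OF assms(10,11) L2_M0[OF assms(12) KF] KF(1) simplex[OF KF(1)]
          facet[OF KF] _ v, of \<beta> "b K"] trace_\<beta>[OF KF(1)] facet(2)[OF KF] by blast
    have "bdry_pairing \<T> (MHDG_flux \<beta> q u l) (\<lambda>K F x. elem_trace K w x - \<mu> x)
      = bdry_pairing \<T> (MHDG_flux \<beta> q u l) (\<lambda>K F x. elem_trace K w x)
        - bdry_pairing \<T> (MHDG_flux \<beta> q u l) (\<lambda>K F x. \<mu> x)"
    proof (rule bdry_pairing_diff)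
      fix K F assume KF: "K \<in> \<T>" "F facet_of K"
      show "set_integrable (surface_measure F) F (\<lambda>x. MHDG_flux \<beta> q u l K F x * \<mu> x)"
        using integrable[OF KF L2_M0[OF \<mu> KF]] .
      obtain g where g: "continuous_on UNIV g" "\<And>x. x \<in> K \<Longrightarrow> elem_trace K w x = g x"
        using W_space_elem_trace[OF w KF(1) simplex[OF KF(1)]] by metis
      have "set_integrable (surface_measure F) F (\<lambda>x. MHDG_flux \<beta> q u l K F x * g x)"
        using integrable[OF KF] continuous_in_L2_surface_measure facet(1)[OF KF] g(1) by blast
      also have "?this \<longleftrightarrow> set_integrable (surface_measure F) F
          (\<lambda>x. MHDG_flux \<beta> q u l K F x * elem_trace K w x)"
        by (intro set_integrable_cong refl) (use g(2) facet(2)[OF KF] in auto)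
      finally show "set_integrable (surface_measure F) F
          (\<lambda>x. MHDG_flux \<beta> q u l K F x * elem_trace K w x)" .
    qed
    then show ?thesis
      using div_\<beta> flux by (simp flip: MHDG_flux_def)
  qed
  then show ?thesis
    by (simp only: cong: ball_cong)
qed

end
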